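(* Let $n$ be a positive integer, let $X,Y\in M_n(\mathbb{C})$ be Hermitian matrices, and let $f$ be a continuous, concave, real-valued function on an interval $I\subseteq\mathbb{R}$ containing the numerical ranges of $X$ and $Y$. Suppose that $f$ is strictly increasing on $I$ or strictly decreasing on $I$. If $$\langle f(X)\xi,\xi\rangle\leq f(\langle Y\xi,\xi\rangle)\quad\text{and}\quad \langle f(Y)\xi,\xi\rangle\leq f(\langle X\xi,\xi\rangle)$$ for every unit vector $\xi\in\mathbb{C}^n$, then $X=Y$.
   Context: $\langle\cdot,\cdot\rangle$ is the standard inner product on $\mathbb{C}^n$. The numerical range of a Hermitian matrix $A$ is $\{\langle A\xi,\xi\rangle : \xi\in\mathbb{C}^n,\ \|\xi\|=1\}$. $f(A)$ is defined by the functional calculus for Hermitian matrices. *)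

theory Defs
  imports "HOL-Analysis.Analysis"
begin

definition cinner :: "complex ^ 'n \<Rightarrow> complex ^ 'n \<Rightarrow> complex" where
  "cinner x y = (\<Sum>i\<in>UNIV. x $ i * cnj (y $ i))"

definition hermitian :: "complex ^ 'n ^ 'n \<Rightarrow> bool" where
  "hermitian A \<longleftrightarrow> (\<forall>i j. A $ i $ j = cnj (A $ j $ i))"

definition numerical_range :: "complex ^ 'n ^ 'n \<Rightarrow> complex set" where
  "numerical_range A = {cinner (A *v \<xi>) \<xi> | \<xi>. norm \<xi> = 1}"

definition eigenspace :: "complex ^ 'n ^ 'n \<Rightarrow> real \<Rightarrow> (complex ^ 'n) set" where
  "eigenspace A l = {v. A *v v = complex_of_real l *s v}"

(* Only real eigenvalues are collected; for Hermitian A this is the whole spectrum. *)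
definition real_spectrum :: "complex ^ 'n ^ 'n \<Rightarrow> real set" where
  "real_spectrum A = {l. \<exists>v \<in> eigenspace A l. v \<noteq> 0}"

(* The norm of complex ^ 'n is the one induced by cinner, so the closest-point map
   of a (complex) subspace is the cinner-orthogonal projection onto it. *)
definition spectral_projection :: "complex ^ 'n ^ 'n \<Rightarrow> real \<Rightarrow> complex ^ 'n ^ 'n" where
  "spectral_projection A l = matrix (closest_point (eigenspace A l))"

(* Functional calculus through the spectral decomposition A = (\<Sum>l. l P_l).
   It is meaningful for Hermitian A only, and uses f only on the spectrum of A. *)
definition fun_calc :: "(real \<Rightarrow> real) \<Rightarrow> complex ^ 'n ^ 'n \<Rightarrow> complex ^ 'n ^ 'n" where
  "fun_calc f A = (\<Sum>l\<in>real_spectrum A. f l *\<^sub>R spectral_projection A l)"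

end

theory Submission
  imports Defs
begin

text \<open>
  If \<open>b\<close> is a unit eigenvector of \<open>X\<close> with eigenvalue \<open>l\<close>, then \<open>f(X) b = f(l) b\<close>, so the first
  inequality reads \<open>f(l) \<le> f(\<langle>Y b, b\<rangle>)\<close>, and strict monotonicity removes \<open>f\<close>: for increasing \<open>f\<close> it
  says \<open>\<langle>X b, b\<rangle> = l \<le> \<langle>Y b, b\<rangle>\<close>, for decreasing \<open>f\<close> the reverse (lemma
  \<open>eigenvalue_fun_le\<close>). What remains is a rigidity property of two Hermitian matrices, lemma
  \<open>hermitian_eqI_eigenvectors\<close>, which rests on traces.

  Summing over an orthonormal eigenbasis of \<open>X\<close> gives \<open>tr X \<le> tr Y\<close> (for
  decreasing \<open>f\<close>, this and the next inequality are reversed); the second inequality,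
  summed over an eigenbasis of \<open>Y\<close>, gives \<open>tr Y \<le> tr X\<close>. So both sums are equalities, and hence
  so is each of their terms: \<open>\<langle>Y b, b\<rangle> = l\<close> for every \<open>b\<close> in the eigenbasis of \<open>X\<close>. Multiplying by
  \<open>l\<close> and summing again gives \<open>tr (Y X) = tr (X X)\<close>, and likewise \<open>tr (X Y) = tr (Y Y)\<close>. Therefore
  \<open>tr ((X - Y)\<^sup>2) = 0\<close>. For a Hermitian matrix the trace of the square is the sum of the squared
  moduli of the entries, so \<open>X = Y\<close>.

  The spectral theorem (\<open>orthonormal_eigenbasis_exists\<close>) supplies the eigenbases. It also shows
  that the closest-point maps in the definition of the functional calculus are complex linear,
  which is what lets the matrices built from them act as projections
  (\<open>spectral_projection_works\<close>).
\<close>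

section \<open>The inner product\<close>

text \<open>This equation gives access to the real Euclidean geometry of the library: norms, compactness,
  dimension bounds, closest points.\<close>

lemma Re_cinner: "Re (cinner x y) = x \<bullet> y"
  by (simp add: cinner_def inner_vec_def inner_complex_def)

lemma cinner_add_left: "cinner (x + y) z = cinner x z + cinner y z"
  by (simp add: cinner_def algebra_simps sum.distrib)

lemma cinner_diff_left: "cinner (x - y) z = cinner x z - cinner y z"
  by (simp add: cinner_def algebra_simps sum_subtractf)

lemma cinner_scale_left: "cinner (c *s x) z = c * cinner x z"
  by (simp add: cinner_def sum_distrib_left mult.assoc)

lemma cinner_sum_left: "cinner (\<Sum>a\<in>S. g a) z = (\<Sum>a\<in>S. cinner (g a) z)"
  by (induction S rule: infinite_finite_induct) (auto simp: cinner_add_left, simp_all add: cinner_def)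

lemma cinner_commute: "cinner y x = cnj (cinner x y)"
  by (simp add: cinner_def mult.commute)

lemma cinner_scale_right: "cinner x (c *s z) = cnj c * cinner x z"
  by (simp add: cinner_commute[of x] cinner_scale_left)

lemma cinner_self: "cinner x x = complex_of_real ((norm x)\<^sup>2)"
  by (rule complex_eqI) (simp_all add: Re_cinner power2_norm_eq_inner, simp add: cinner_def)

lemma cinner_hermitian:
  assumes "hermitian A"
  shows "cinner (A *v x) y = cinner x (A *v y)"
proof -
  have "cinner (A *v x) y = (\<Sum>i\<in>UNIV. \<Sum>j\<in>UNIV. A $ i $ j * x $ j * cnj (y $ i))"
    by (simp add: cinner_def matrix_vector_mult_def sum_distrib_right)
  also have "\<dots> = (\<Sum>j\<in>UNIV. \<Sum>i\<in>UNIV. A $ i $ j * x $ j * cnj (y $ i))"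
    by (rule sum.swap)
  also have "\<dots> = (\<Sum>j\<in>UNIV. \<Sum>i\<in>UNIV. x $ j * cnj (A $ j $ i * y $ i))"
    using assms unfolding hermitian_def by (intro sum.cong refl) (metis complex_cnj_mult mult.assoc mult.commute)
  also have "\<dots> = cinner x (A *v y)"
    by (simp add: cinner_def matrix_vector_mult_def sum_distrib_left)
  finally show ?thesis .
qed

lemma inner_hermitian: "hermitian A \<Longrightarrow> (A *v x) \<bullet> y = x \<bullet> (A *v y)"
  by (simp add: cinner_hermitian flip: Re_cinner)

lemma matrix_vector_mult_scaleR_right:
  fixes A :: "complex ^ 'n ^ 'm"
  shows "A *v (t *\<^sub>R x) = t *\<^sub>R (A *v x)"
  by (simp add: vec_eq_iff matrix_vector_mult_def scaleR_sum_right)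

lemma matrix_vector_mult_sum_right: "A *v (\<Sum>a\<in>S. g a) = (\<Sum>a\<in>S. A *v g a)"
  by (induction S rule: infinite_finite_induct) (simp_all add: matrix_vector_right_distrib)

lemma matrix_vector_mult_sum_left: "(\<Sum>a\<in>S. M a) *v x = (\<Sum>a\<in>S. M a *v x)"
  by (induction S rule: infinite_finite_induct) (simp_all add: matrix_vector_mult_add_rdistrib)

lemma of_real_scale: "complex_of_real t *s x = t *\<^sub>R x"
  by (simp add: vec_eq_iff scaleR_conv_of_real[where 'a = complex])

section \<open>The spectral theorem\<close>

text \<open>The first-order condition at the minimum \<open>t = 0\<close> of a real quadratic polynomial.\<close>

lemma quadratic_nonneg_linear_zero:
  fixes a b :: real
  assumes "\<And>t. 0 \<le> 2 * t * a + t\<^sup>2 * b"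
  shows "a = 0"
proof (rule ccontr)
  assume "a \<noteq> 0"
  have "b > 0 \<or> b \<le> 0" by auto
  then show False
  proof
    assume "b > 0"
    have "2 * (- a / b) * a + (- a / b)\<^sup>2 * b = - (a\<^sup>2 / b)"
      using \<open>b > 0\<close> by (simp add: field_simps power2_eq_square)
    with assms[of "- a / b"] have "a\<^sup>2 / b \<le> 0" by linarith
    with \<open>b > 0\<close> \<open>a \<noteq> 0\<close> show False by (simp add: divide_le_0_iff)
  next
    assume "b \<le> 0"
    have "2 * (- a) * a + (- a)\<^sup>2 * b = a\<^sup>2 * b - 2 * a\<^sup>2"
      by (simp add: power2_eq_square)
    moreover have "a\<^sup>2 * b \<le> 0" "a\<^sup>2 > 0"
      using \<open>b \<le> 0\<close> \<open>a \<noteq> 0\<close> by (auto simp: mult_nonneg_nonpos)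
    ultimately show False using assms[of "- a"] by linarith
  qed
qed

text \<open>A maximum point \<open>u\<close> of the quadratic form of \<open>A\<close> on the unit sphere of \<open>W\<close> exists by
  compactness and is an eigenvector. Indeed, with \<open>m\<close> the maximum, the form
  \<open>q w = m (w \<bullet> w) - (A w) \<bullet> w\<close> is nonnegative on \<open>W\<close> and vanishes at \<open>u\<close>, so its derivative at \<open>u\<close>
  in each direction \<open>h\<close> of \<open>W\<close> vanishes. As \<open>W\<close> is invariant, \<open>h = m u - A u\<close> is an admissible
  direction, and the derivative in this direction is \<open>2 (h \<bullet> h)\<close>.\<close>

lemma eigenvector_in_invariant_subspace:
  fixes A :: "complex ^ 'n ^ 'n"
  assumes "hermitian A" "subspace W" "\<And>w. w \<in> W \<Longrightarrow> A *v w \<in> W" "W \<noteq> {0}"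
  obtains u l where "u \<in> W" "norm u = 1" "u \<in> eigenspace A l"
proof -
  let ?S = "sphere 0 1 \<inter> W"
  have "compact ?S"
    using assms(2) by (intro compact_Int_closed closed_subspace) auto
  moreover have "?S \<noteq> {}"
  proof -
    obtain w where "w \<in> W" "w \<noteq> 0" using assms(2,4) subspace_0 by blast
    then have "w /\<^sub>R norm w \<in> ?S" using assms(2) by (auto intro: subspace_scale)
    then show ?thesis by blast
  qed
  moreover have "continuous_on ?S (\<lambda>v. (A *v v) \<bullet> v)"
    by (intro continuous_intros linear_continuous_on)
      (simp add: linear_conv_bounded_linear[symmetric] linear_iff matrix_vector_right_distrib
        matrix_vector_mult_scaleR_right)
  ultimately obtain u where u: "u \<in> ?S" and max: "\<And>v. v \<in> ?S \<Longrightarrow> (A *v v) \<bullet> v \<le> (A *v u) \<bullet> u"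
    using continuous_attains_sup[of ?S "\<lambda>v. (A *v v) \<bullet> v"] by blast
  define m where "m = (A *v u) \<bullet> u"
  define q where "q w = m * (w \<bullet> w) - (A *v w) \<bullet> w" for w
  define h where "h = m *\<^sub>R u - A *v u"
  have q_nonneg: "0 \<le> q w" if "w \<in> W" for w
  proof (cases "w = 0")
    case False
    have "w /\<^sub>R norm w \<in> ?S" using assms(2) that False by (auto intro: subspace_scale)
    from max[OF this] have "(A *v w) \<bullet> w / (norm w * norm w) \<le> m"
      by (simp add: m_def matrix_vector_mult_scaleR_right field_simps)
    then show ?thesis using False
      by (simp add: q_def power2_norm_eq_inner[symmetric] power2_eq_square field_simps)
  qed (simp add: q_def)
  have "h \<in> W" using u assms(2,3) by (auto simp: h_def intro!: subspace_diff subspace_scale)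
  have "u \<bullet> u = 1" using u by (simp add: power2_norm_eq_inner[symmetric])
  have "0 \<le> 2 * t * (h \<bullet> h) + t\<^sup>2 * q h" for t
  proof -
    have "u + t *\<^sub>R h \<in> W"
      using u \<open>h \<in> W\<close> assms(2) by (auto intro!: subspace_add subspace_scale)
    then have "0 \<le> q (u + t *\<^sub>R h)" by (rule q_nonneg)
    also have "q (u + t *\<^sub>R h) = q u + 2 * t * (m * (u \<bullet> h) - (A *v u) \<bullet> h) + t\<^sup>2 * q h"
      using inner_hermitian[OF assms(1), of h u]
      by (simp add: q_def matrix_vector_right_distrib matrix_vector_mult_scaleR_right inner_add_left
          inner_add_right algebra_simps power2_eq_square inner_commute)
    also have "m * (u \<bullet> h) - (A *v u) \<bullet> h = h \<bullet> h"
      by (simp add: h_def inner_diff_left)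
    also have "q u = 0" by (simp add: q_def m_def \<open>u \<bullet> u = 1\<close>)
    finally show ?thesis by simp
  qed
  then have "h \<bullet> h = 0" by (rule quadratic_nonneg_linear_zero)
  then have "u \<in> eigenspace A m" by (simp add: h_def eigenspace_def of_real_scale)
  then show thesis using that u by auto
qed

definition orthonormal_eigenvectors :: "complex ^ 'n ^ 'n \<Rightarrow> (complex ^ 'n) set \<Rightarrow> bool" where
  "orthonormal_eigenvectors A B \<longleftrightarrow>
     (\<forall>b\<in>B. norm b = 1 \<and> (\<exists>l. b \<in> eigenspace A l)) \<and>
     (\<forall>b\<in>B. \<forall>c\<in>B. b \<noteq> c \<longrightarrow> cinner b c = 0)"

text \<open>The bound is the real dimension, twice the complex one. It only has to guarantee that a set
  of maximal cardinality exists.\<close>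

lemma orthonormal_eigenvectors_bound:
  fixes A :: "complex ^ 'n ^ 'n"
  assumes "orthonormal_eigenvectors A B"
  shows "finite B \<and> card B \<le> DIM(complex ^ 'n)"
proof -
  have "pairwise orthogonal B" "0 \<notin> B"
    using assms by (auto simp: orthonormal_eigenvectors_def pairwise_def orthogonal_def simp flip: Re_cinner)
  then show ?thesis using pairwise_orthogonal_independent independent_bound by blast
qed

text \<open>The orthogonal complement \<open>W\<close> of an orthonormal set of eigenvectors is invariant under \<open>A\<close>. If
  the set has maximal cardinality, then \<open>W\<close> is trivial, since an eigenvector in \<open>W\<close> would enlarge
  the set. The basis property is stated as the Fourier expansion of every vector, the form in
  which it is used for projections and traces.\<close>

lemma orthonormal_eigenbasis_exists:
  fixes A :: "complex ^ 'n ^ 'n"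
  assumes "hermitian A"
  obtains B where "orthonormal_eigenvectors A B" "\<And>x. x = (\<Sum>b\<in>B. cinner x b *s b)"
proof -
  have "\<exists>B. orthonormal_eigenvectors A B \<and> (\<forall>C. orthonormal_eigenvectors A C \<longrightarrow> card C \<le> card B)"
  proof (rule ex_has_greatest_nat)
    show "orthonormal_eigenvectors A {}" by (simp add: orthonormal_eigenvectors_def)
    show "\<forall>C. orthonormal_eigenvectors A C \<longrightarrow> card C < Suc DIM(complex ^ 'n)"
      using orthonormal_eigenvectors_bound by (blast intro: le_imp_less_Suc)
  qed
  then obtain B where B: "orthonormal_eigenvectors A B"
    and max: "\<And>C. orthonormal_eigenvectors A C \<Longrightarrow> card C \<le> card B" by blast
  have "finite B" using orthonormal_eigenvectors_bound[OF B] by blast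
  define W where "W = {w. \<forall>b\<in>B. cinner w b = 0}"
  have "W = {0}"
  proof (rule ccontr)
    assume "W \<noteq> {0}"
    moreover have "subspace W"
      by (auto simp: subspace_def W_def cinner_add_left cinner_scale_left simp flip: of_real_scale)
        (simp add: cinner_def)
    moreover have "A *v w \<in> W" if "w \<in> W" for w
    proof -
      have "cinner (A *v w) b = 0" if "b \<in> B" for b
      proof -
        obtain l where "A *v b = complex_of_real l *s b"
          using B \<open>b \<in> B\<close> unfolding orthonormal_eigenvectors_def eigenspace_def by blast
        then show ?thesis
          using \<open>w \<in> W\<close> \<open>b \<in> B\<close> by (simp add: cinner_hermitian[OF assms] cinner_scale_right W_def)
      qed
      then show ?thesis by (simp add: W_def)
    qed
    ultimately obtain u l where u: "u \<in> W" "norm u = 1" "u \<in> eigenspace A l"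
      using eigenvector_in_invariant_subspace[OF assms] by metis
    then have "cinner u b = 0" "cinner b u = 0" if "b \<in> B" for b
      using that by (auto simp: W_def cinner_commute[of b])
    then have "orthonormal_eigenvectors A (insert u B)"
      using B u by (auto simp: orthonormal_eigenvectors_def)
    from max[OF this] \<open>finite B\<close> have "u \<in> B" by (cases "u \<in> B") auto
    with u have "cinner u u = 0" by (auto simp: W_def)
    with u show False by (simp add: cinner_self)
  qed
  have "x = (\<Sum>b\<in>B. cinner x b *s b)" for x
  proof -
    have "cinner (x - (\<Sum>b\<in>B. cinner x b *s b)) c = 0" if "c \<in> B" for c
    proof -
      have "cinner (\<Sum>b\<in>B. cinner x b *s b) c = (\<Sum>b\<in>B. if b = c then cinner x c else 0)"
        unfolding cinner_sum_left using B that
        by (intro sum.cong) (auto simp: orthonormal_eigenvectors_def cinner_scale_left cinner_self)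
      then show ?thesis using \<open>finite B\<close> that by (simp add: cinner_diff_left)
    qed
    then have "x - (\<Sum>b\<in>B. cinner x b *s b) \<in> W" by (simp add: W_def)
    then show ?thesis using \<open>W = {0}\<close> by simp
  qed
  then show thesis using that B by blast
qed

section \<open>The functional calculus on eigenvectors\<close>

lemma eigenspaces_orthogonal:
  assumes "hermitian A" "v \<in> eigenspace A l" "w \<in> eigenspace A m" "l \<noteq> m"
  shows "cinner v w = 0"
proof -
  have "complex_of_real l * cinner v w = complex_of_real m * cinner v w"
    using cinner_hermitian[OF assms(1), of v w] assms(2,3)
    by (simp add: eigenspace_def cinner_scale_left cinner_scale_right)
  then show ?thesis using assms(4) by simp
qed

lemma subspace_eigenspace: "subspace (eigenspace A l)"
  by (auto simp: subspace_def eigenspace_def matrix_vector_right_distrib of_real_scale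
      matrix_vector_mult_scaleR_right scaleR_add_right)

lemma closest_point_subspace:
  fixes E :: "'a::euclidean_space set"
  assumes "subspace E" "p \<in> E" "\<And>e. e \<in> E \<Longrightarrow> (x - p) \<bullet> e = 0"
  shows "closest_point E x = p"
proof -
  have "dist x p \<le> dist x e" if "e \<in> E" for e
  proof -
    have "p - e \<in> E" using assms(1,2) that by (rule subspace_diff)
    then have "(norm (x - e))\<^sup>2 = (norm (x - p))\<^sup>2 + (norm (p - e))\<^sup>2"
      using assms(3)[of "p - e"] norm_add_Pythagorean[of "x - p" "p - e"]
      by (simp add: orthogonal_def)
    then have "(norm (x - p))\<^sup>2 \<le> (norm (x - e))\<^sup>2" by simp
    then show ?thesis by (simp add: dist_norm)
  qed
  then show ?thesis
    using closest_point_unique[of E p x] assms(1,2) closed_subspace subspace_imp_convex by metis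
qed

text \<open>The closest-point map is thus given by a formula that is visibly complex linear in \<open>x\<close>. The
  difference between \<open>x\<close> and the right-hand side is the part of the expansion of \<open>x\<close> along the
  eigenvectors for the other eigenvalues, which are orthogonal to the eigenspace.\<close>

lemma closest_point_eigenspace:
  assumes "hermitian A" "orthonormal_eigenvectors A B" "\<And>x. x = (\<Sum>b\<in>B. cinner x b *s b)"
  shows "closest_point (eigenspace A l) x = (\<Sum>b\<in>B \<inter> eigenspace A l. cinner x b *s b)"
    (is "_ = ?p")
proof (rule closest_point_subspace)
  show "subspace (eigenspace A l)" by (rule subspace_eigenspace)
  have "finite B" using orthonormal_eigenvectors_bound[OF assms(2)] by blast
  show "?p \<in> eigenspace A l"
    by (simp add: eigenspace_def matrix_vector_mult_sum_right vec.scale_sum_right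
        vector_scalar_commute mult.commute)
  fix e assume e: "e \<in> eigenspace A l"
  have "x = ?p + (\<Sum>b\<in>B - eigenspace A l. cinner x b *s b)"
    by (rule trans[OF assms(3)[of x] sum.Int_Diff[OF \<open>finite B\<close>]])
  then have "x - ?p = (\<Sum>b\<in>B - eigenspace A l. cinner x b *s b)"
    by (simp only: diff_eq_eq add.commute)
  then have "cinner (x - ?p) e = (\<Sum>b\<in>B - eigenspace A l. cinner x b * cinner b e)"
    by (simp only: cinner_sum_left cinner_scale_left)
  also have "\<dots> = 0"
  proof (intro sum.neutral ballI)
    fix b assume b: "b \<in> B - eigenspace A l"
    then obtain m where "b \<in> eigenspace A m" using assms(2) by (auto simp: orthonormal_eigenvectors_def)
    with b have "cinner b e = 0" using eigenspaces_orthogonal[OF assms(1) _ e] by blast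
    then show "cinner x b * cinner b e = 0" by simp
  qed
  finally show "(x - ?p) \<bullet> e = 0" by (simp flip: Re_cinner)
qed

text \<open>The operator \<open>matrix\<close> records only the images of the standard basis vectors, so this needs
  the linearity of the closest-point map over the complex numbers.\<close>

lemma spectral_projection_works:
  fixes A :: "complex ^ 'n ^ 'n"
  assumes "hermitian A"
  shows "spectral_projection A l *v x = closest_point (eigenspace A l) x"
proof -
  obtain B where B: "orthonormal_eigenvectors A B" "\<And>x. x = (\<Sum>b\<in>B. cinner x b *s b)"
    using orthonormal_eigenbasis_exists[OF assms] by metis
  have "Vector_Spaces.linear (*s) (*s) (closest_point (eigenspace A l))"
    unfolding closest_point_eigenspace[OF assms B, abs_def]
    by unfold_locales
      (simp_all add: cinner_add_left cinner_scale_left vec.scale_left_distrib sum.distrib vec.scale_sum_right)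
  then show ?thesis unfolding spectral_projection_def by (rule matrix_works)
qed

text \<open>The sum defining the functional calculus is zero by convention if its index set is infinite,
  so finiteness is needed to evaluate it.\<close>

lemma finite_real_spectrum:
  fixes A :: "complex ^ 'n ^ 'n"
  assumes "hermitian A"
  shows "finite (real_spectrum A)"
proof -
  have "\<forall>l\<in>real_spectrum A. \<exists>v. v \<in> eigenspace A l \<and> v \<noteq> 0"
    by (auto simp: real_spectrum_def)
  then obtain v where v: "\<And>l. l \<in> real_spectrum A \<Longrightarrow> v l \<in> eigenspace A l \<and> v l \<noteq> 0"
    by metis
  have orth: "v l \<bullet> v m = 0" if "l \<in> real_spectrum A" "m \<in> real_spectrum A" "l \<noteq> m" for l m
    using that v eigenspaces_orthogonal[OF assms] by (metis Re_cinner zero_complex.sel(1))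
  have "pairwise orthogonal (v ` real_spectrum A)" "0 \<notin> v ` real_spectrum A"
    using orth v by (fastforce simp: pairwise_def orthogonal_def)+
  then have "finite (v ` real_spectrum A)"
    using pairwise_orthogonal_independent independent_bound by blast
  moreover have "inj_on v (real_spectrum A)"
    using orth v by (metis inj_onI inner_eq_zero_iff)
  ultimately show ?thesis using finite_imageD by blast
qed

lemma fun_calc_eigenvector:
  assumes "hermitian A" "v \<in> eigenspace A l"
  shows "fun_calc f A *v v = f l *\<^sub>R v"
proof (cases "v = 0")
  case False
  have proj: "spectral_projection A m *v v = (if m = l then v else 0)" for m
  proof (cases "m = l")
    case True
    then show ?thesis
      using assms by (simp add: spectral_projection_works closest_point_self)
  next
    case neq: False
    have "closest_point (eigenspace A m) v = 0"
      using eigenspaces_orthogonal[OF assms(1,2)] neq subspace_0[OF subspace_eigenspace]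
      by (intro closest_point_subspace) (auto simp: subspace_eigenspace simp flip: Re_cinner)
    then show ?thesis using assms neq by (simp add: spectral_projection_works)
  qed
  have "fun_calc f A *v v = (\<Sum>m\<in>real_spectrum A. f m *\<^sub>R (spectral_projection A m *v v))"
    unfolding fun_calc_def matrix_vector_mult_sum_left
    by (simp add: vec_eq_iff matrix_vector_mult_def scaleR_sum_right)
  also have "\<dots> = (\<Sum>m\<in>real_spectrum A. if m = l then f l *\<^sub>R v else 0)"
    by (intro sum.cong) (auto simp: proj)
  also have "\<dots> = f l *\<^sub>R v"
    using finite_real_spectrum[OF assms(1)] assms(2) False by (auto simp: real_spectrum_def)
  finally show ?thesis .
qed simp

section \<open>Traces and rigidity of Hermitian matrices\<close>

text \<open>Expanding each standard basis vector in \<open>B\<close> turns the diagonal entries of \<open>M\<close> into sums over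
  \<open>B\<close>; for an orthonormal basis this is the basis independence of the trace.\<close>

lemma trace_fourier_expansion:
  fixes M :: "complex ^ 'n ^ 'n"
  assumes "\<And>x. x = (\<Sum>b\<in>B. cinner x b *s b)"
  shows "trace M = (\<Sum>b\<in>B. cinner (M *v b) b)"
proof -
  have "M $ i $ i = (\<Sum>b\<in>B. (M *v b) $ i * cnj (b $ i))" for i
  proof -
    have "M $ i $ i = (M *v axis i 1) $ i"
      by (simp add: matrix_vector_mult_def axis_def if_distrib[of "\<lambda>z. _ * z"] cong: if_cong)
    also have "axis i 1 = (\<Sum>b\<in>B. cnj (b $ i) *s b)"
      using assms[of "axis i 1"]
      by (simp add: cinner_def axis_def if_distrib[of "\<lambda>z. z * _"] cong: if_cong)
    also have "(M *v (\<Sum>b\<in>B. cnj (b $ i) *s b)) $ i = (\<Sum>b\<in>B. (M *v b) $ i * cnj (b $ i))"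
      by (simp add: matrix_vector_mult_sum_right vector_scalar_commute mult.commute)
    finally show ?thesis .
  qed
  then show ?thesis unfolding trace_def cinner_def by (simp add: sum.swap[of _ B])
qed

text \<open>In an orthonormal eigenbasis of \<open>X\<close>, the hypothesis compares the diagonal entries of \<open>X\<close> and
  \<open>Y\<close>. If the traces agree, no entry can differ, so \<open>X\<close> and \<open>Y\<close> have the same diagonal, and
  then so do \<open>X X\<close> and \<open>Y X\<close>, because \<open>X\<close> is diagonal in this basis. The sign of the factor \<open>s\<close>
  fixes the direction of the comparison, which treats increasing and decreasing functions
  together.\<close>

lemma trace_mono_on_eigenvectors:
  fixes X Y :: "complex ^ 'n ^ 'n"
  assumes "hermitian X"
    and le: "\<And>b l. norm b = 1 \<Longrightarrow> b \<in> eigenspace X l \<Longrightarrow> s * l \<le> s * Re (cinner (Y *v b) b)"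
  shows "s * Re (trace X) \<le> s * Re (trace Y)"
    and "s \<noteq> 0 \<Longrightarrow> Re (trace Y) = Re (trace X) \<Longrightarrow> Re (trace (Y ** X)) = Re (trace (X ** X))"
proof -
  obtain B where B: "orthonormal_eigenvectors X B" "\<And>x. x = (\<Sum>b\<in>B. cinner x b *s b)"
    using orthonormal_eigenbasis_exists[OF assms(1)] by metis
  have "finite B" using orthonormal_eigenvectors_bound[OF B(1)] by blast
  obtain ev where ev: "\<And>b. b \<in> B \<Longrightarrow> b \<in> eigenspace X (ev b)"
    using B(1) unfolding orthonormal_eigenvectors_def by metis
  have unit: "\<And>b. b \<in> B \<Longrightarrow> norm b = 1" using B(1) by (simp add: orthonormal_eigenvectors_def)
  note tr = trace_fourier_expansion[OF B(2)]
  let ?y = "\<lambda>b. Re (cinner (Y *v b) b)"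
  have act: "X *v b = ev b *\<^sub>R b" if "b \<in> B" for b
    using ev[OF that] by (simp add: eigenspace_def of_real_scale)
  have trX: "Re (trace X) = (\<Sum>b\<in>B. ev b)"
    by (simp add: tr act Re_cinner unit flip: power2_norm_eq_inner)
  have trY: "Re (trace Y) = (\<Sum>b\<in>B. ?y b)" by (simp add: tr)
  have le': "s * ev b \<le> s * ?y b" if "b \<in> B" for b using le ev unit that by blast
  show "s * Re (trace X) \<le> s * Re (trace Y)"
    unfolding trX trY sum_distrib_left by (intro sum_mono le')
  assume "s \<noteq> 0" and eq: "Re (trace Y) = Re (trace X)"
  have sums_eq: "(\<Sum>b\<in>B. s * ev b) = (\<Sum>b\<in>B. s * ?y b)"
    using eq by (simp add: trX trY flip: sum_distrib_left)
  have "s * ev b = s * ?y b" if "b \<in> B" for b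
    by (rule sum_mono_inv[OF sums_eq le' that \<open>finite B\<close>])
  then have "?y b = ev b" if "b \<in> B" for b using that \<open>s \<noteq> 0\<close> by simp
  then show "Re (trace (Y ** X)) = Re (trace (X ** X))"
    by (simp add: tr act matrix_vector_mult_scaleR_right Re_cinner unit
        flip: matrix_vector_mul_assoc power2_norm_eq_inner)
qed

text \<open>The trace of \<open>Z Z\<close> is the squared Frobenius norm of \<open>Z\<close>, because \<open>Z\<close> is its own adjoint.\<close>

lemma hermitian_trace_square_zero:
  assumes "hermitian Z" "Re (trace (Z ** Z)) = 0"
  shows "Z = 0"
proof -
  have "Re (trace (Z ** Z)) = (\<Sum>i\<in>UNIV. \<Sum>j\<in>UNIV. (norm (Z $ i $ j))\<^sup>2)"
    unfolding trace_def matrix_matrix_mult_def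
  proof (simp, intro sum.cong refl)
    fix i j
    have "Z $ j $ i = cnj (Z $ i $ j)" using assms(1) unfolding hermitian_def by metis
    then show "Re (Z $ i $ j) * Re (Z $ j $ i) - Im (Z $ i $ j) * Im (Z $ j $ i) = (norm (Z $ i $ j))\<^sup>2"
      unfolding cmod_power2 by (simp add: power2_eq_square)
  qed
  with assms(2) show ?thesis
    by (simp add: sum_nonneg_eq_0_iff sum_nonneg vec_eq_iff)
qed

text \<open>The two comparisons force equal traces, hence
  \<open>tr (X X) = tr (Y X) = tr (X Y) = tr (Y Y)\<close>, and the Frobenius norm of \<open>X - Y\<close> vanishes.\<close>

lemma hermitian_eqI_eigenvectors:
  fixes X Y :: "complex ^ 'n ^ 'n"
  assumes X: "hermitian X" and Y: "hermitian Y" and "s \<noteq> 0"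
    and XY: "\<And>b l. norm b = 1 \<Longrightarrow> b \<in> eigenspace X l \<Longrightarrow> s * l \<le> s * Re (cinner (Y *v b) b)"
    and YX: "\<And>b l. norm b = 1 \<Longrightarrow> b \<in> eigenspace Y l \<Longrightarrow> s * l \<le> s * Re (cinner (X *v b) b)"
  shows "X = Y"
proof -
  have eq: "Re (trace X) = Re (trace Y)"
    using trace_mono_on_eigenvectors(1)[OF X XY] trace_mono_on_eigenvectors(1)[OF Y YX] \<open>s \<noteq> 0\<close>
    by simp
  have "Re (trace (Y ** X)) = Re (trace (X ** X))" "Re (trace (X ** Y)) = Re (trace (Y ** Y))"
    using trace_mono_on_eigenvectors(2)[OF X XY \<open>s \<noteq> 0\<close>] eq
      trace_mono_on_eigenvectors(2)[OF Y YX \<open>s \<noteq> 0\<close>] by simp_all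
  moreover have "trace (X ** Y) = trace (Y ** X)" by (rule trace_mul_sym)
  moreover have "(X - Y) ** (X - Y) = X ** X - X ** Y - (Y ** X - Y ** Y)"
    by (simp add: vec_eq_iff matrix_matrix_mult_def algebra_simps sum.distrib sum_subtractf)
  ultimately have "Re (trace ((X - Y) ** (X - Y))) = 0" by (simp add: trace_sub)
  moreover have "hermitian (X - Y)"
    unfolding hermitian_def
  proof (intro allI)
    fix i j
    have "X $ i $ j = cnj (X $ j $ i)" "Y $ i $ j = cnj (Y $ j $ i)"
      using X Y unfolding hermitian_def by blast+
    then show "(X - Y) $ i $ j = cnj ((X - Y) $ j $ i)"
      by (simp only: vector_minus_component complex_cnj_diff)
  qed
  ultimately show ?thesis using hermitian_trace_square_zero by fastforce
qed

section \<open>Comparing values of a monotone function\<close>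

text \<open>On an eigenvector, the matrix inequality becomes an inequality between two values of \<open>f\<close>.
  Both arguments are points of the numerical ranges, so a monotonicity assumption on \<open>I\<close> can be
  applied to them.\<close>

lemma eigenvalue_fun_le:
  assumes "hermitian X" "norm b = 1" "b \<in> eigenspace X l"
    and "numerical_range X \<subseteq> complex_of_real ` I" "numerical_range Y \<subseteq> complex_of_real ` I"
    and le: "Re (cinner (fun_calc f X *v b) b) \<le> f (Re (cinner (Y *v b) b))"
  shows "l \<in> I" "Re (cinner (Y *v b) b) \<in> I" "f l \<le> f (Re (cinner (Y *v b) b))"
proof -
  have "cinner (X *v b) b = complex_of_real l"
    using assms(2,3) by (simp add: eigenspace_def cinner_scale_left cinner_self)
  then have "complex_of_real l \<in> numerical_range X"
    using assms(2) unfolding numerical_range_def by force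
  then show "l \<in> I" using assms(4) by auto
  have "cinner (Y *v b) b \<in> numerical_range Y"
    using assms(2) unfolding numerical_range_def by blast
  then show "Re (cinner (Y *v b) b) \<in> I" using assms(5) by auto
  show "f l \<le> f (Re (cinner (Y *v b) b))"
    using le assms(2) by (simp add: fun_calc_eigenvector[OF assms(1,3)] Re_cinner flip: power2_norm_eq_inner)
qed

theorem corollary2p2:
  fixes X Y :: "complex ^ 'n ^ 'n"
    and f :: "real \<Rightarrow> real"
    and I :: "real set"
  assumes "hermitian X" and "hermitian Y"
    and "is_interval I"
    and "numerical_range X \<subseteq> complex_of_real ` I"
    and "numerical_range Y \<subseteq> complex_of_real ` I"
    and "continuous_on I f"
    and "concave_on I f"
    and "strict_mono_on I f \<or> strict_antimono_on I f"
    and "\<And>\<xi> :: complex ^ 'n. norm \<xi> = 1 \<Longrightarrow>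
           Re (cinner (fun_calc f X *v \<xi>) \<xi>) \<le> f (Re (cinner (Y *v \<xi>) \<xi>))"
    and "\<And>\<xi> :: complex ^ 'n. norm \<xi> = 1 \<Longrightarrow>
           Re (cinner (fun_calc f Y *v \<xi>) \<xi>) \<le> f (Re (cinner (X *v \<xi>) \<xi>))"
  shows "X = Y"
proof -
  obtain s :: real where "s \<noteq> 0"
    and s: "\<And>x y. x \<in> I \<Longrightarrow> y \<in> I \<Longrightarrow> f x \<le> f y \<Longrightarrow> s * x \<le> s * y"
    \<comment> \<open>\<open>s = 1\<close> if \<open>f\<close> increases, \<open>s = -1\<close> if it decreases\<close>
  proof (cases "strict_mono_on I f")
    case True
    then have "x \<le> y" if "x \<in> I" "y \<in> I" "f x \<le> f y" for x y
      using that by (meson linorder_not_le strict_mono_onD)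
    then show thesis using that[of 1] by simp
  next
    case False
    with assms(8) have "strict_antimono_on I f" by blast
    then have "y \<le> x" if "x \<in> I" "y \<in> I" "f x \<le> f y" for x y
      using that by (meson linorder_not_le monotone_onD)
    then show thesis using that[of "-1"] by simp
  qed
  show ?thesis
  proof (rule hermitian_eqI_eigenvectors[OF assms(1,2) \<open>s \<noteq> 0\<close>])
    fix b :: "complex ^ 'n" and l assume "norm b = 1" "b \<in> eigenspace X l"
    then show "s * l \<le> s * Re (cinner (Y *v b) b)"
      using eigenvalue_fun_le[OF assms(1) _ _ assms(4,5,9)] s by blast
  next
    fix b :: "complex ^ 'n" and l assume "norm b = 1" "b \<in> eigenspace Y l"
    then show "s * l \<le> s * Re (cinner (X *v b) b)"
      using eigenvalue_fun_le[OF assms(2) _ _ assms(5,4,10)] s by blast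
  qed
qed

end
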